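(* For $\mathcal{I}=\mathcal{F},\mathcal{K},\mathcal{W},\mathcal{S},\mathcal{R},\mathcal{AS}$, the weighted holomorphic ideal $[\mathcal{H}_{v\mathcal{I}}^\infty,\|\cdot\|_v]$ is injective.
   Context: All Banach spaces are complex. $U$ denotes an open subset of a complex Banach space $E$, and $v$ a weight on $U$, i.e. a continuous function $v\colon U\to(0,\infty)$. $\mathcal{H}_v^\infty(U,F)$ is the Banach space of all holomorphic $f\colon U\to F$ with $\|f\|_v:=\sup_{x\in U}v(x)\|f(x)\|<\infty$. $\mathcal{F},\mathcal{K},\mathcal{W},\mathcal{S},\mathcal{R},\mathcal{AS}$ stand for the ideals of finite-rank, compact, weakly compact, separable, Rosenthal and Asplund bounded linear operators, respectively. For $f\in\mathcal{H}_v^\infty(U,F)$ let $(vf)(U)=\{v(x)f(x)\colon x\in U\}\subseteq F$. The space $\mathcal{H}_{v\mathcal{I}}^\infty(U,F)$ consists of all $f\in\mathcal{H}_v^\infty(U,F)$ such that: for $\mathcal{I}=\mathcal{F}$, the linear span of $(vf)(U)$ is finite dimensional; for $\mathcal{I}=\mathcal{K}$, $(vf)(U)$ is relatively compact; for $\mathcal{I}=\mathcal{W}$, $(vf)(U)$ is relatively weakly compact; for $\mathcal{I}=\mathcal{S}$, $(vf)(U)$ is separable; for $\mathcal{I}=\mathcal{R}$, $(vf)(U)$ is a Rosenthal set (every sequence in it has a weakly Cauchy subsequence); for $\mathcal{I}=\mathcal{AS}$, $(vf)(U)$ is an Asplund set (it is bounded and for every countable subset $B$ of it, the seminormed space $(F^*,\rho_B)$,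 $\rho_B(y^* )=\sup_{y\in B}|y^*(y)|$, is separable). Equipped with $\|\cdot\|_v$, each $\mathcal{H}_{v\mathcal{I}}^\infty$ is a normed weighted holomorphic ideal, i.e. an assignment $[\mathcal{A},\|\cdot\|_{\mathcal{A}}]$ of normed spaces $\mathcal{A}(U,F)\subseteq\mathcal{H}_v^\infty(U,F)$ with $\|\cdot\|_v\leq\|\cdot\|_{\mathcal{A}}$, containing the maps $h\cdot y\colon x\mapsto h(x)y$ ($h\in\mathcal{H}_v^\infty(U,\mathbb{C})$, $y\in F$) with $\|h\cdot y\|_{\mathcal{A}}=\|h\|_v\|y\|$, and such that $T\circ f\circ h\in\mathcal{A}(V,G)$ with $\|T\circ f\circ h\|_{\mathcal{A}}\leq\|T\|\|f\|_{\mathcal{A}}c_v(h)$ whenever $V\subseteq U$ is open (with restricted weight), $h\colon V\to U$ is holomorphic with $c_v(h):=\sup_{x\in V}v(x)/v(h(x))<\infty$, $f\in\mathcal{A}(U,F)$ and $T\colon F\to G$ is a bounded linear operator into a complex Banach space $G$. A normed weighted holomorphic ideal $[\mathcal{A},\|\cdot\|_{\mathcal{A}}]$ is injective if for any $f\in\mathcal{H}_v^\infty(U,F)$, any complex Banach space $G$ and any into linear isometry $\iota\colon F\to G$, $\iota\circ f\in\mathcal{A}(U,G)$ implies $f\in\mathcal{A}(U,F)$ with $\|f\|_{\mathcal{A}}=\|\iota\circ f\|_{\mathcal{A}}$. *)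

theory Defs
  imports "HOL-Analysis.Analysis"
begin

text \<open>
  Complex normed and Banach spaces, as type classes on top of the real ones: the real scalar
  multiplication is the restriction of the complex one.
\<close>

class complex_vector = real_vector +
  fixes scaleC :: "complex \<Rightarrow> 'a \<Rightarrow> 'a" (infixr \<open>*\<^sub>C\<close> 75)
  assumes scaleC_add_right: "a *\<^sub>C (x + y) = a *\<^sub>C x + a *\<^sub>C y"
    and scaleC_add_left: "(a + b) *\<^sub>C x = a *\<^sub>C x + b *\<^sub>C x"
    and scaleC_scaleC: "a *\<^sub>C b *\<^sub>C x = (a * b) *\<^sub>C x"
    and scaleC_one: "1 *\<^sub>C x = x"
    and scaleR_eq_scaleC: "r *\<^sub>R x = complex_of_real r *\<^sub>C x"

class complex_normed_vector = complex_vector + real_normed_vector +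
  assumes norm_scaleC: "norm (a *\<^sub>C x) = cmod a * norm x"

class complex_banach = complex_normed_vector + banach

instantiation complex :: complex_banach
begin

definition scaleC_complex :: "complex \<Rightarrow> complex \<Rightarrow> complex"
  where "scaleC_complex = (*)"

instance
  by standard (simp_all add: scaleC_complex_def algebra_simps norm_mult scaleR_conv_of_real)

end

global_interpretation complex_vector:
  vector_space "scaleC :: complex \<Rightarrow> 'a \<Rightarrow> 'a::complex_vector"
  by standard (simp_all add: scaleC_add_right scaleC_add_left scaleC_scaleC scaleC_one)

abbreviation clinear :: "('a::complex_vector \<Rightarrow> 'b::complex_vector) \<Rightarrow> bool"
  where "clinear \<equiv> Vector_Spaces.linear scaleC scaleC"

definition linear_isometry :: "('a::complex_normed_vector \<Rightarrow> 'b::complex_normed_vector) \<Rightarrow> bool"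
  where "linear_isometry \<iota> \<longleftrightarrow> clinear \<iota> \<and> (\<forall>x. norm (\<iota> x) = norm x)"

definition cdual :: "('a::complex_normed_vector \<Rightarrow> complex) set"
  where "cdual = {\<phi>. clinear \<phi> \<and> bounded_linear \<phi>}"

definition weak_topology :: "'a::complex_normed_vector topology"
  where "weak_topology = topology_generated_by {\<phi> -` W | \<phi> W. \<phi> \<in> cdual \<and> open W}"


subsection \<open>Small subsets of a complex Banach space\<close>

text \<open>A linear span is finite dimensional iff it is spanned by a finite set.\<close>

definition finite_dim_span :: "'a::complex_vector set \<Rightarrow> bool"
  where "finite_dim_span S \<longleftrightarrow>
    (\<exists>B. finite B \<and> complex_vector.span S = complex_vector.span B)"

definition relatively_compact :: "'a::topological_space set \<Rightarrow> bool"
  where "relatively_compact S \<longleftrightarrow> compact (closure S)"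

definition relatively_weakly_compact :: "'a::complex_normed_vector set \<Rightarrow> bool"
  where "relatively_weakly_compact S \<longleftrightarrow> compactin weak_topology (weak_topology closure_of S)"

definition weakly_Cauchy :: "(nat \<Rightarrow> 'a::complex_normed_vector) \<Rightarrow> bool"
  where "weakly_Cauchy s \<longleftrightarrow> (\<forall>\<phi>\<in>cdual. Cauchy (\<lambda>n. \<phi> (s n)))"

definition Rosenthal_set :: "'a::complex_normed_vector set \<Rightarrow> bool"
  where "Rosenthal_set S \<longleftrightarrow>
    (\<forall>s::nat \<Rightarrow> 'a. (\<forall>n. s n \<in> S) \<longrightarrow> (\<exists>r::nat \<Rightarrow> nat. strict_mono r \<and> weakly_Cauchy (s \<circ> r)))"

text \<open>
  Here and in the weighted norm below, the inserted \<open>0\<close> only fixes the value of a supremum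
  over the empty set; all other suprema are of nonempty sets of nonnegative reals.
\<close>

definition dual_seminorm :: "'a::complex_normed_vector set \<Rightarrow> ('a \<Rightarrow> complex) \<Rightarrow> real"
  where "dual_seminorm B \<phi> = Sup (insert 0 ((\<lambda>y. cmod (\<phi> y)) ` B))"

definition separable_dual_seminorm :: "'a::complex_normed_vector set \<Rightarrow> bool"
  where "separable_dual_seminorm B \<longleftrightarrow>
    (\<exists>D\<subseteq>cdual. countable D \<and>
      (\<forall>\<phi>\<in>cdual. \<forall>\<epsilon>>0. \<exists>\<psi>\<in>D. dual_seminorm B (\<lambda>y. \<phi> y - \<psi> y) < \<epsilon>))"

definition Asplund_set :: "'a::complex_normed_vector set \<Rightarrow> bool"
  where "Asplund_set S \<longleftrightarrow>
    bounded S \<and> (\<forall>B\<subseteq>S. countable B \<longrightarrow> separable_dual_seminorm B)"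


subsection \<open>Weighted spaces of holomorphic maps\<close>

text \<open>
  Maps on \<open>U\<close> are represented by total functions whose values outside \<open>U\<close> are irrelevant.
\<close>

definition weight_on :: "'e::complex_banach set \<Rightarrow> ('e \<Rightarrow> real) \<Rightarrow> bool"
  where "weight_on U v \<longleftrightarrow> continuous_on U v \<and> (\<forall>x\<in>U. v x > 0)"

text \<open>Holomorphic means complex Frechet differentiable at each point of the open set \<open>U\<close>.\<close>

definition holomorphic_map_on ::
    "('e::complex_banach \<Rightarrow> 'f::complex_banach) \<Rightarrow> 'e set \<Rightarrow> bool"
  where "holomorphic_map_on f U \<longleftrightarrow>
    (\<forall>x\<in>U. \<exists>f'. clinear f' \<and> (f has_derivative f') (at x))"

definition weighted_norm ::
    "'e::complex_banach set \<Rightarrow> ('e \<Rightarrow> real) \<Rightarrow> ('e \<Rightarrow> 'f::complex_banach) \<Rightarrow> real"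
  where "weighted_norm U v f = Sup (insert 0 ((\<lambda>x. v x * norm (f x)) ` U))"

definition Hv :: "'e::complex_banach set \<Rightarrow> ('e \<Rightarrow> real) \<Rightarrow> ('e \<Rightarrow> 'f::complex_banach) set"
  where "Hv U v = {f. holomorphic_map_on f U \<and> bdd_above ((\<lambda>x. v x * norm (f x)) ` U)}"

definition weighted_range ::
    "'e::complex_banach set \<Rightarrow> ('e \<Rightarrow> real) \<Rightarrow> ('e \<Rightarrow> 'f::complex_banach) \<Rightarrow> 'f set"
  where "weighted_range U v f = (\<lambda>x. v x *\<^sub>R f x) ` U"

datatype operator_ideal =
  Finite_Rank | Compact | Weakly_Compact | Separable | Rosenthal | Asplund

fun ideal_set :: "operator_ideal \<Rightarrow> 'f::complex_banach set \<Rightarrow> bool"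
  where
    "ideal_set Finite_Rank S \<longleftrightarrow> finite_dim_span S"
  | "ideal_set Compact S \<longleftrightarrow> relatively_compact S"
  | "ideal_set Weakly_Compact S \<longleftrightarrow> relatively_weakly_compact S"
  | "ideal_set Separable S \<longleftrightarrow> separable_space (top_of_set S)"
  | "ideal_set Rosenthal S \<longleftrightarrow> Rosenthal_set S"
  | "ideal_set Asplund S \<longleftrightarrow> Asplund_set S"

definition HvI ::
    "operator_ideal \<Rightarrow> 'e::complex_banach set \<Rightarrow> ('e \<Rightarrow> real) \<Rightarrow> ('e \<Rightarrow> 'f::complex_banach) set"
  where "HvI I U v = {f \<in> Hv U v. ideal_set I (weighted_range U v f)}"

text \<open>
  Injectivity of a normed weighted holomorphic ideal: \<open>A\<^sub>F\<close>, \<open>n\<^sub>F\<close> and \<open>A\<^sub>G\<close>, \<open>n\<^sub>G\<close> are the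
  components and norms of the ideal at the target spaces \<open>F\<close> and \<open>G\<close>. HOL cannot quantify over
  types inside a formula, so the ideal is injective when the predicate holds for all instances
  of the type variables.
\<close>

definition injective_ideal ::
    "'e::complex_banach set \<Rightarrow> ('e \<Rightarrow> real) \<Rightarrow>
      ('e \<Rightarrow> 'f::complex_banach) set \<Rightarrow> (('e \<Rightarrow> 'f) \<Rightarrow> real) \<Rightarrow>
      ('e \<Rightarrow> 'g::complex_banach) set \<Rightarrow> (('e \<Rightarrow> 'g) \<Rightarrow> real) \<Rightarrow> bool"
  where "injective_ideal U v A\<^sub>F n\<^sub>F A\<^sub>G n\<^sub>G \<longleftrightarrow>
    (\<forall>f\<in>Hv U v. \<forall>\<iota>::'f \<Rightarrow> 'g. linear_isometry \<iota> \<longrightarrow> \<iota> \<circ> f \<in> A\<^sub>G \<longrightarrow>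
      f \<in> A\<^sub>F \<and> n\<^sub>F f = n\<^sub>G (\<iota> \<circ> f))"

end

theory Submission
  imports Defs
begin

text \<open>
  An isometry \<open>\<iota>\<close> commutes with multiplication by the weight, so the weighted range of \<open>\<iota> \<circ> f\<close>
  is the image under \<open>\<iota>\<close> of the weighted range of \<open>f\<close>, and the two weighted norms agree. The
  claim thus reduces to a statement about sets: each of the six smallness properties of \<open>\<iota> ` S\<close>
  passes to \<open>S\<close> (\<open>ideal_set_isometry_imageD\<close>).

  For finite dimension this is the injectivity of \<open>\<iota>\<close>, and separability follows from the
  continuity of the inverse of \<open>\<iota>\<close> on its range. The Rosenthal and Asplund properties are
  formulated with functionals, and there the point is that every functional on the small space is
  \<open>\<Phi> \<circ> \<iota>\<close> for a functional \<open>\<Phi>\<close> on the large one (\<open>cdual_extends_along_isometry\<close>), which is the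
  Hahn-Banach theorem. Compactness and weak compactness share a topological argument
  (\<open>compactin_closure_of_embedding_imageD\<close>): an embedding with closed range pulls compact closures
  back. In the norm topology the range is closed by completeness. In the weak topology both the
  embedding property and the closedness of the range come from Hahn-Banach, by extension and by
  separation of a point from the range respectively.

  Extension and separation are two instances of the sandwich theorem \<open>sandwich\<close>: if a sublinear
  \<open>p\<close> satisfies \<open>r \<le> p c\<close> for all pairs \<open>(c, r)\<close> of a convex cone, then some linear \<open>q \<le> p\<close> does
  too. Its proof works throughout with functionals defined on the whole space: the constraints are
  first absorbed into a smaller sublinear functional, Zorn's lemma yields a minimal sublinear
  functional below that one, and minimality forces linearity.
\<close>

section \<open>Sublinear functionals\<close>

definition sublinear :: "('a::real_vector \<Rightarrow> real) \<Rightarrow> bool"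
  where "sublinear q \<longleftrightarrow>
    (\<forall>x y. q (x + y) \<le> q x + q y) \<and> (\<forall>t>0. \<forall>x. q (t *\<^sub>R x) \<le> t * q x)"

lemma sublinear_add: "sublinear q \<Longrightarrow> q (x + y) \<le> q x + q y"
  by (simp add: sublinear_def)

lemma sublinear_scaleR_le: "sublinear q \<Longrightarrow> t > 0 \<Longrightarrow> q (t *\<^sub>R x) \<le> t * q x"
  by (simp add: sublinear_def)

lemma sublinear_scaleR:
  assumes "sublinear q" "t > 0"
  shows "q (t *\<^sub>R x) = t * q x"
proof (rule antisym)
  have "q ((1 / t) *\<^sub>R (t *\<^sub>R x)) \<le> (1 / t) * q (t *\<^sub>R x)"
    using assms by (intro sublinear_scaleR_le) auto
  then show "t * q x \<le> q (t *\<^sub>R x)"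
    using \<open>t > 0\<close> by (simp add: field_simps)
qed (use assms sublinear_scaleR_le in blast)

lemma sublinear_zero: "sublinear q \<Longrightarrow> q 0 = 0"
  using sublinear_scaleR[of q 2 0] by simp

lemma sublinear_ge_neg: "sublinear q \<Longrightarrow> - q (- x) \<le> q x"
  using sublinear_add[of q x "- x"] sublinear_zero[of q] by simp

lemma sublinear_norm: "sublinear (norm :: 'a::real_normed_vector \<Rightarrow> real)"
  by (simp add: sublinear_def norm_triangle_ineq)

text \<open>
  For sublinear \<open>p\<close> and a convex cone \<open>K\<close>, every linear functional below this one lies below \<open>p\<close>
  (take \<open>(0, 0)\<close> in the infimum) and satisfies the constraints in \<open>K\<close>, since at \<open>x = - c\<close> the
  competitor \<open>(c, r)\<close> has the value \<open>- r\<close>. The lower bounds \<open>r\<close> on values at \<open>c\<close> are a set of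
  pairs rather than a function of \<open>c\<close>, so that a cone may be given by any
  parametrisation, injective or not.
\<close>

definition cone_reduction :: "('a::real_vector \<times> real) set \<Rightarrow> ('a \<Rightarrow> real) \<Rightarrow> 'a \<Rightarrow> real"
  where "cone_reduction K p x = (INF (c, r)\<in>K. p (x + c) - r)"

lemma cone_reduction_lower:
  assumes p: "sublinear p" and dom: "\<And>c r. (c, r) \<in> K \<Longrightarrow> r \<le> p c" and "(c, r) \<in> K"
  shows "cone_reduction K p x \<le> p (x + c) - r"
proof -
  have "bdd_below ((\<lambda>(c, r). p (x + c) - r) ` K)"
  proof (rule bdd_belowI2, clarify)
    fix c r assume "(c, r) \<in> K"
    \<comment> \<open>Subadditivity and the constraint at \<open>c\<close> bound the infimum independently of the pair.\<close>
    then show "- p (- x) \<le> p (x + c) - r"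
      using sublinear_add[OF p, of "x + c" "- x"] dom[of c r] by simp
  qed
  from cINF_lower[OF this \<open>(c, r) \<in> K\<close>] show ?thesis
    by (simp add: cone_reduction_def)
qed

lemma cone_reduction_greatest:
  assumes "K \<noteq> {}" "\<And>c r. (c, r) \<in> K \<Longrightarrow> b \<le> p (x + c) - r"
  shows "b \<le> cone_reduction K p x"
  unfolding cone_reduction_def using assms by (intro cINF_greatest) auto

lemma sublinear_cone_reduction:
  assumes p: "sublinear p" and dom: "\<And>c r. (c, r) \<in> K \<Longrightarrow> r \<le> p c" and K: "convex_cone K"
  shows "sublinear (cone_reduction K p)"
proof -
  note lower = cone_reduction_lower[of p K, OF p dom]
  have ne: "K \<noteq> {}" using K by (simp add: convex_cone_def)
  have add: "cone_reduction K p (x + y) \<le> cone_reduction K p x + cone_reduction K p y" for x y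
  proof -
    have "cone_reduction K p (x + y) - cone_reduction K p y \<le> cone_reduction K p x"
    proof (rule cone_reduction_greatest[OF ne])
      fix c r assume cr: "(c, r) \<in> K"
      have "cone_reduction K p (x + y) - (p (x + c) - r) \<le> cone_reduction K p y"
      proof (rule cone_reduction_greatest[OF ne])
        fix d s assume "(d, s) \<in> K"
        then have "(c + d, r + s) \<in> K" using convex_cone_add[OF K cr, of "(d, s)"] by simp
        then have "cone_reduction K p (x + y) \<le> p ((x + c) + (y + d)) - (r + s)"
          using lower[of "c + d" "r + s" "x + y"] by (simp add: algebra_simps)
        then show "cone_reduction K p (x + y) - (p (x + c) - r) \<le> p (y + d) - s"
          using sublinear_add[OF p, of "x + c" "y + d"] by simp
      qed
      then show "cone_reduction K p (x + y) - cone_reduction K p y \<le> p (x + c) - r" by simp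
    qed
    then show ?thesis by simp
  qed
  have scale: "cone_reduction K p (t *\<^sub>R x) \<le> t * cone_reduction K p x" if t: "t > 0" for t x
  proof -
    have "cone_reduction K p (t *\<^sub>R x) / t \<le> cone_reduction K p x"
    proof (rule cone_reduction_greatest[OF ne])
      fix c r assume "(c, r) \<in> K"
      then have "(t *\<^sub>R c, t * r) \<in> K" using convex_cone_scaleR[OF K, of t "(c, r)"] t by simp
      then have "cone_reduction K p (t *\<^sub>R x) \<le> t * (p (x + c) - r)"
        using lower[of "t *\<^sub>R c" "t * r" "t *\<^sub>R x"]
        by (simp add: sublinear_scaleR[OF p t] right_diff_distrib flip: scaleR_add_right)
      then show "cone_reduction K p (t *\<^sub>R x) / t \<le> p (x + c) - r"
        using t by (simp add: pos_divide_le_eq mult.commute)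
    qed
    then show ?thesis using t by (simp add: field_simps)
  qed
  show ?thesis by (simp add: sublinear_def add scale)
qed

text \<open>
  Zorn's lemma for the reversed pointwise order. The pointwise infimum of a chain below \<open>p\<close> is
  finite because each member \<open>q\<close> has \<open>q x \<ge> - q (- x) \<ge> - p (- x)\<close>.
\<close>

lemma exists_minimal_sublinear:
  assumes p: "sublinear p"
  obtains q where "sublinear q" "q \<le> p" "\<And>q'. sublinear q' \<Longrightarrow> q' \<le> q \<Longrightarrow> q' = q"
proof -
  let ?A = "{q. sublinear q \<and> q \<le> p}"
  have "\<exists>u\<in>?A. \<forall>a\<in>C. u \<le> a" if C: "C \<in> Chains (relation_of (\<ge>) ?A)" for C
  proof (cases "C = {}")
    case True
    then show ?thesis using p by auto
  next
    case False
    have sub: "sublinear q" and le: "q \<le> p" if "q \<in> C" for q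
      using Chains_relation_of[OF C] that by auto
    have comparable: "a \<le> b \<or> b \<le> a" if "a \<in> C" "b \<in> C" for a b
      using C that by (auto simp: Chains_def relation_of_def)
    let ?u = "\<lambda>x. INF q\<in>C. q x"
    have bdd: "bdd_below ((\<lambda>q. q x) ` C)" for x
    proof (rule bdd_belowI2)
      fix q assume "q \<in> C"
      then show "- p (- x) \<le> q x"
        using sublinear_ge_neg[OF sub, of q x] le_funD[OF le, of q "- x"] by simp
    qed
    have low: "?u x \<le> q x" if "q \<in> C" for q x
      using cINF_lower[OF bdd that] .
    have add: "?u (x + y) \<le> ?u x + ?u y" for x y
    proof -
      have "?u (x + y) - ?u y \<le> ?u x"
      proof (rule cINF_greatest[OF False])
        fix a assume a: "a \<in> C"
        have "?u (x + y) - a x \<le> ?u y"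
        proof (rule cINF_greatest[OF False])
          fix b assume b: "b \<in> C"
          \<comment> \<open>Infima of subadditive maps need not be subadditive; along a chain, the smaller of
            two members serves both arguments.\<close>
          obtain c where c: "c \<in> C" "c \<le> a" "c \<le> b"
            using comparable[OF a b] a b by blast
          have "?u (x + y) \<le> c x + c y"
            using low[OF c(1), of "x + y"] sublinear_add[OF sub[OF c(1)], of x y] by simp
          then show "?u (x + y) - a x \<le> b y"
            using le_funD[OF c(2), of x] le_funD[OF c(3), of y] by simp
        qed
        then show "?u (x + y) - ?u y \<le> a x" by simp
      qed
      then show ?thesis by simp
    qed
    have scale: "?u (t *\<^sub>R x) \<le> t * ?u x" if t: "t > 0" for t x
    proof -
      have "?u (t *\<^sub>R x) / t \<le> ?u x"
      proof (rule cINF_greatest[OF False])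
        fix a assume a: "a \<in> C"
        show "?u (t *\<^sub>R x) / t \<le> a x"
          using low[OF a, of "t *\<^sub>R x"] t
          by (simp add: sublinear_scaleR[OF sub[OF a] t] field_simps)
      qed
      then show ?thesis using t by (simp add: field_simps)
    qed
    obtain a where a: "a \<in> C" using False by blast
    have "?u \<le> p" using low[OF a] le_funD[OF le[OF a]] by (intro le_funI) (rule order_trans)
    moreover have "sublinear ?u" by (simp add: sublinear_def add scale)
    ultimately show ?thesis using low by (intro bexI[of _ ?u]) (auto intro!: le_funI)
  qed
  moreover have "partial_order_on ?A (relation_of (\<ge>) ?A)"
    by (rule partial_order_on_relation_ofI) auto
  ultimately obtain q where "q \<in> ?A" "\<forall>q'\<in>?A. q' \<le> q \<longrightarrow> q' = q"
    using predicate_Zorn[of ?A "(\<ge>)"] by auto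
  then show ?thesis by (intro that[of q]) auto
qed

text \<open>
  Reducing \<open>q\<close> by the ray through a point \<open>y\<close>, with its own values as constraints, gives a sublinear
  functional below \<open>q\<close> whose value at \<open>x\<close> is at most \<open>q (x + y) - q y\<close>. By minimality it equals
  \<open>q\<close>, so \<open>q\<close> is superadditive.
\<close>

lemma linear_if_minimal_sublinear:
  assumes q: "sublinear q" and min: "\<And>q'. sublinear q' \<Longrightarrow> q' \<le> q \<Longrightarrow> q' = q"
  shows "linear q"
proof -
  have superadd: "q x + q y \<le> q (x + y)" for x y
  proof -
    let ?K = "(\<lambda>t. (t *\<^sub>R y, t * q y)) ` {0..}"
    have "linear (\<lambda>t. (t *\<^sub>R y, t * q y))"
      by (intro linearI) (simp_all add: algebra_simps)
    then have K: "convex_cone ?K"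
      by (intro convex_cone_linear_image conjI) (simp_all add: convex_cone_iff)
    have dom: "r \<le> q c" if "(c, r) \<in> ?K" for c r
      using that sublinear_zero[OF q] sublinear_scaleR[OF q] by (auto simp: le_less)
    note low = cone_reduction_lower[of q ?K, OF q dom]
    have "cone_reduction ?K q \<le> q"
      using low[of 0 0] by (intro le_funI) (force simp: image_iff)
    then have "cone_reduction ?K q = q"
      using min sublinear_cone_reduction[OF q dom K] by blast
    moreover have "cone_reduction ?K q x \<le> q (x + y) - q y"
      using low[of y "q y" x] by (force simp: image_iff)
    ultimately show ?thesis by simp
  qed
  have add: "q (x + y) = q x + q y" for x y
    using superadd[of x y] sublinear_add[OF q, of x y] by simp
  have neg: "q (- x) = - q x" for x
    using add[of x "- x"] sublinear_zero[OF q] by simp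
  have "q (t *\<^sub>R x) = t * q x" for t x
  proof (cases t "0::real" rule: linorder_cases)
    case less
    then show ?thesis using sublinear_scaleR[OF q, of "- t" x] neg[of "t *\<^sub>R x"] by simp
  qed (use sublinear_zero[OF q] sublinear_scaleR[OF q] in auto)
  with add show ?thesis by (intro linearI) auto
qed

text \<open>The Hahn-Banach theorem in the sandwich form of Mazur and Orlicz.\<close>

theorem sandwich:
  assumes p: "sublinear p" and dom: "\<And>c r. (c, r) \<in> K \<Longrightarrow> r \<le> p c" and K: "convex_cone K"
  obtains q where "linear q" "\<And>x. q x \<le> p x" "\<And>c r. (c, r) \<in> K \<Longrightarrow> r \<le> q c"
proof -
  obtain q where q: "sublinear q" "q \<le> cone_reduction K p"
    and min: "\<And>q'. sublinear q' \<Longrightarrow> q' \<le> q \<Longrightarrow> q' = q"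
    using exists_minimal_sublinear[OF sublinear_cone_reduction[OF p dom K]] by blast
  have lin: "linear q" by (rule linear_if_minimal_sublinear[OF q(1) min])
  have low: "q x \<le> p (x + c) - r" if "(c, r) \<in> K" for x c r
    using le_funD[OF q(2), of x] cone_reduction_lower[OF p dom that, of x] by simp
  show ?thesis
  proof (rule that[OF lin])
    have "(0, 0) \<in> K" using convex_cone_contains_0[OF K] by (simp add: zero_prod_def)
    from low[OF this] show "q x \<le> p x" for x by simp
    show "r \<le> q c" if "(c, r) \<in> K" for c r
      using low[OF that, of "- c"] sublinear_zero[OF p] linear_neg[OF lin, of c] by simp
  qed
qed

section \<open>Bounded complex linear functionals\<close>

lemma clinearI:
  fixes f :: "'a::complex_vector \<Rightarrow> 'b::complex_vector"
  assumes "\<And>x y. f (x + y) = f x + f y" "\<And>c x. f (c *\<^sub>C x) = c *\<^sub>C f x"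
  shows "clinear f"
  using assms by (simp add: Vector_Spaces.linear_iff complex_vector.vector_space_axioms)

lemma clinear_add: "clinear f \<Longrightarrow> f (x + y) = f x + f y"
  and clinear_scaleC: "clinear f \<Longrightarrow> f (c *\<^sub>C x) = c *\<^sub>C f x"
  by (simp_all add: Vector_Spaces.linear_iff)

lemma clinear_imp_linear:
  fixes f :: "'a::complex_vector \<Rightarrow> 'b::complex_vector"
  assumes "clinear f"
  shows "linear f"
  by (intro linearI) (simp_all add: scaleR_eq_scaleC clinear_add[OF assms] clinear_scaleC[OF assms])

text \<open>
  A complex linear functional is determined by its real part \<open>q\<close>, through
  \<open>Im (\<Phi> x) = - Re (\<Phi> (\<i> x))\<close>. The one-sided bound on \<open>q\<close> is two-sided by linearity.
\<close>

lemma complexify_functional: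
  fixes q :: "'a::complex_normed_vector \<Rightarrow> real"
  assumes q: "linear q" and le: "\<And>x. q x \<le> K * norm x"
  shows "(\<lambda>x. Complex (q x) (- q (\<i> *\<^sub>C x))) \<in> cdual" (is "?\<Phi> \<in> _")
proof -
  have neg: "q (- x) = - q x" for x by (rule linear_neg[OF q])
  have abs: "\<bar>q x\<bar> \<le> K * norm x" for x
    using le[of x] le[of "- x"] by (simp add: neg abs_le_iff)
  have add: "?\<Phi> (x + y) = ?\<Phi> x + ?\<Phi> y" for x y
    by (simp add: linear_add[OF q] scaleC_add_right complex_eq_iff)
  have real: "q (complex_of_real r *\<^sub>C x) = r * q x" for r x
    using linear_cmul[OF q, of r x] by (simp add: scaleR_eq_scaleC)
  have scale: "?\<Phi> (c *\<^sub>C x) = c * ?\<Phi> x" for c x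
  proof -
    have c: "c *\<^sub>C x = complex_of_real (Re c) *\<^sub>C x + complex_of_real (Im c) *\<^sub>C \<i> *\<^sub>C x"
      unfolding scaleC_scaleC scaleC_add_left[symmetric]
      by (rule arg_cong[of _ _ "\<lambda>c. c *\<^sub>C x"]) (simp add: complex_eq_iff)
    have ic: "\<i> *\<^sub>C c *\<^sub>C x =
        complex_of_real (Re c) *\<^sub>C \<i> *\<^sub>C x + complex_of_real (- Im c) *\<^sub>C x"
      unfolding scaleC_scaleC scaleC_add_left[symmetric]
      by (rule arg_cong[of _ _ "\<lambda>c. c *\<^sub>C x"]) (simp add: complex_eq_iff)
    have "q (c *\<^sub>C x) = Re c * q x + Im c * q (\<i> *\<^sub>C x)"
      by (subst c) (simp only: linear_add[OF q] real)
    moreover have "q (\<i> *\<^sub>C c *\<^sub>C x) = Re c * q (\<i> *\<^sub>C x) + (- Im c) * q x"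
      by (subst ic) (simp only: linear_add[OF q] real)
    ultimately show ?thesis by (simp add: complex_eq_iff)
  qed
  have clin: "clinear ?\<Phi>"
    by (rule clinearI) (use add scale in \<open>simp_all add: scaleC_complex_def\<close>)
  moreover have "bounded_linear ?\<Phi>"
  proof (rule bounded_linear_intro)
    show "?\<Phi> (x + y) = ?\<Phi> x + ?\<Phi> y" for x y by (rule add)
    show "?\<Phi> (r *\<^sub>R x) = r *\<^sub>R ?\<Phi> x" for r x
      by (rule linear_cmul[OF clinear_imp_linear[OF clin]])
    show "norm (?\<Phi> x) \<le> norm x * (2 * K)" for x
      using cmod_le[of "?\<Phi> x"] abs[of x] abs[of "\<i> *\<^sub>C x"]
      by (simp add: norm_scaleC algebra_simps)
  qed
  ultimately show ?thesis by (simp add: cdual_def)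
qed

lemma linear_isometryD:
  assumes "linear_isometry \<iota>"
  shows "clinear \<iota>" "linear \<iota>" "norm (\<iota> x) = norm x" "bounded_linear \<iota>" "inj \<iota>"
proof -
  show c: "clinear \<iota>" and n: "norm (\<iota> x) = norm x" for x
    using assms by (auto simp: linear_isometry_def)
  show l: "linear \<iota>" by (rule clinear_imp_linear[OF c])
  show "bounded_linear \<iota>"
    by (rule bounded_linear_intro[of _ 1]) (simp_all add: linear_add[OF l] linear_cmul[OF l] n)
  show "inj \<iota>"
    unfolding linear_injective_0[OF l] using n by (metis norm_eq_zero)
qed

lemma cdual_compose_isometry:
  assumes "linear_isometry \<iota>" "\<Phi> \<in> cdual"
  shows "\<Phi> \<circ> \<iota> \<in> cdual"
proof -
  have "bounded_linear (\<Phi> \<circ> \<iota>)"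
    using assms(2) linear_isometryD(4)[OF assms(1)] bounded_linear_compose[of \<Phi> \<iota>]
    by (simp add: cdual_def comp_def)
  moreover have "clinear (\<Phi> \<circ> \<iota>)"
    using assms linear_isometryD(1)[OF assms(1)]
    by (auto simp: cdual_def clinear_add clinear_scaleC intro!: clinearI)
  ultimately show ?thesis by (simp add: cdual_def)
qed

text \<open>
  The sandwich theorem for the subspace of pairs \<open>(\<iota> x, Re (\<phi> x))\<close>. On a subspace the lower bounds
  are attained, as they apply to \<open>- x\<close> as well.
\<close>

lemma cdual_extends_along_isometry:
  fixes \<iota> :: "'f::complex_normed_vector \<Rightarrow> 'g::complex_normed_vector"
  assumes \<iota>: "linear_isometry \<iota>" and \<phi>: "\<phi> \<in> cdual"
  obtains \<Phi> where "\<Phi> \<in> cdual" "\<Phi> \<circ> \<iota> = \<phi>"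
proof -
  note iso = linear_isometryD[OF \<iota>]
  have cl: "clinear \<phi>" and bl: "bounded_linear \<phi>" using \<phi> by (auto simp: cdual_def)
  have l: "linear \<phi>" by (rule clinear_imp_linear[OF cl])
  obtain M where M: "M > 0" "\<And>x. norm (\<phi> x) \<le> norm x * M"
    using bounded_linear.pos_bounded[OF bl] by blast
  let ?K = "range (\<lambda>x. (\<iota> x, Re (\<phi> x)))"
  have "linear (\<lambda>x. (\<iota> x, Re (\<phi> x)))"
    by (intro linearI) (simp_all add: linear_add[OF iso(2)] linear_cmul[OF iso(2)]
      linear_add[OF l] linear_cmul[OF l])
  then have "subspace ?K" by (rule linear_subspace_image) simp
  then have K: "convex_cone ?K" by (rule subspace_imp_convex_cone)
  have p: "sublinear (\<lambda>x::'g. M * norm x)"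
    using M(1) by (auto simp: sublinear_def distrib_left[symmetric] norm_triangle_ineq)
  have dom: "r \<le> M * norm c" if "(c, r) \<in> ?K" for c r
  proof -
    from that obtain x where x: "c = \<iota> x" "r = Re (\<phi> x)" by auto
    show ?thesis using M(2)[of x] complex_Re_le_cmod[of "\<phi> x"] by (simp add: x iso mult.commute)
  qed
  obtain q where q: "linear q" "\<And>x. q x \<le> M * norm x" "\<And>c r. (c, r) \<in> ?K \<Longrightarrow> r \<le> q c"
    using sandwich[OF p dom K] by blast
  have ge: "Re (\<phi> x) \<le> q (\<iota> x)" for x by (rule q(3)) blast
  have re: "q (\<iota> x) = Re (\<phi> x)" for x
    using ge[of x] ge[of "- x"]
    by (simp add: linear_neg[OF l] linear_neg[OF q(1)] linear_neg[OF iso(2)])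
  let ?\<Phi> = "\<lambda>x. Complex (q x) (- q (\<i> *\<^sub>C x))"
  have "q (\<i> *\<^sub>C \<iota> x) = - Im (\<phi> x)" for x
    unfolding clinear_scaleC[OF iso(1), symmetric] re
    by (simp add: clinear_scaleC[OF cl] scaleC_complex_def)
  then have "?\<Phi> \<circ> \<iota> = \<phi>" by (simp add: fun_eq_iff complex_eq_iff re)
  then show ?thesis using complexify_functional[OF q(1,2)] that by blast
qed

text \<open>
  With \<open>d\<close> at most the distance of \<open>y\<close> to the range, the constraints demand a functional that is
  nonnegative on the range, hence zero there, and at least \<open>d\<close> at \<open>y\<close>. They are compatible with the
  norm because \<open>t * d \<le> norm (\<iota> x + t *\<^sub>R y)\<close> for \<open>t \<ge> 0\<close>.
\<close>

lemma cdual_separates_closed_range: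
  fixes \<iota> :: "'f::complex_normed_vector \<Rightarrow> 'g::complex_normed_vector"
  assumes \<iota>: "linear_isometry \<iota>" and closed: "closed (range \<iota>)" and y: "y \<notin> range \<iota>"
  obtains \<Phi> where "\<Phi> \<in> cdual" "\<And>x. \<Phi> (\<iota> x) = 0" "\<Phi> y \<noteq> 0"
proof -
  note iso = linear_isometryD[OF \<iota>]
  have "open (- range \<iota>)" using closed by (simp add: open_Compl)
  then obtain d where d: "d > 0" "ball y d \<subseteq> - range \<iota>"
    using y open_contains_ball[of "- range \<iota>"] by blast
  have far: "d \<le> norm (\<iota> x + y)" for x
  proof -
    have "\<iota> (- x) \<notin> ball y d" using d(2) by blast
    then show ?thesis by (simp add: dist_norm linear_neg[OF iso(2)] add.commute)
  qed
  let ?K = "(\<lambda>(x, t). (\<iota> x + t *\<^sub>R y, t * d)) ` (UNIV \<times> {0..})"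
  have "linear (\<lambda>(x, t). (\<iota> x + t *\<^sub>R y, t * d))"
    by (intro linearI)
      (auto simp: algebra_simps linear_add[OF iso(2)] linear_cmul[OF iso(2)])
  moreover have "convex_cone (UNIV \<times> {0..} :: ('f \<times> real) set)"
    by (intro convex_cone_Times) (simp_all add: convex_cone_iff)
  ultimately have K: "convex_cone ?K"
    by (intro convex_cone_linear_image conjI)
  have dom: "r \<le> norm c" if "(c, r) \<in> ?K" for c r
  proof -
    from that obtain x t where x: "c = \<iota> x + t *\<^sub>R y" "r = t * d" "t \<ge> 0" by auto
    show ?thesis
    proof (cases "t = 0")
      case False
      then have "c = t *\<^sub>R (\<iota> ((1 / t) *\<^sub>R x) + y)"
        unfolding linear_cmul[OF iso(2)] by (simp add: x scaleR_add_right)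
      then have "norm c = t * norm (\<iota> ((1 / t) *\<^sub>R x) + y)" using x(3) by simp
      with far x show ?thesis by (simp add: mult_left_mono)
    qed (simp add: x)
  qed
  obtain q where q: "linear q" "\<And>x. q x \<le> norm x" "\<And>c r. (c, r) \<in> ?K \<Longrightarrow> r \<le> q c"
    using sandwich[OF sublinear_norm dom K] by blast
  have ge: "0 \<le> q (\<iota> x)" for x
    by (rule q(3)) (force intro!: image_eqI[of _ _ "(x, 0)"])
  have zero: "q (\<iota> x) = 0" for x
    using ge[of x] ge[of "- x"] by (simp add: linear_neg[OF q(1)] linear_neg[OF iso(2)])
  have "d \<le> q y"
    by (rule q(3)) (force intro!: image_eqI[of _ _ "(0, 1)"] simp: linear_0[OF iso(2)])
  show ?thesis
  proof (rule that)
    show "(\<lambda>x. Complex (q x) (- q (\<i> *\<^sub>C x))) \<in> cdual"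
      using complexify_functional[OF q(1), of 1] q(2) by simp
    show "Complex (q (\<iota> x)) (- q (\<i> *\<^sub>C \<iota> x)) = 0" for x
      by (simp add: zero clinear_scaleC[OF iso(1), symmetric] complex_eq_iff)
    show "Complex (q y) (- q (\<i> *\<^sub>C y)) \<noteq> 0"
      using d(1) \<open>d \<le> q y\<close> by (simp add: complex_eq_iff)
  qed
qed

section \<open>Isometries and the weak topology\<close>

text \<open>The zero functional contributes the whole space to the subbasis.\<close>

lemma Union_weak_subbasis:
  "\<Union> {\<phi> -` W | \<phi> W. \<phi> \<in> cdual \<and> open W} = (UNIV :: 'a::complex_normed_vector set)"
proof -
  have "(\<lambda>_. 0) \<in> (cdual :: ('a \<Rightarrow> complex) set)"
    unfolding cdual_def by (intro CollectI conjI clinearI) (simp_all add: scaleC_complex_def)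
  then have "(\<lambda>_::'a. 0::complex) -` UNIV \<in> {\<phi> -` W | \<phi> W. \<phi> \<in> cdual \<and> open W}"
    by (intro CollectI exI conjI) (rule refl, assumption, rule open_UNIV)
  from Union_upper[OF this] show ?thesis by (simp add: top.extremum_unique)
qed

lemma topspace_weak_topology [simp]: "topspace weak_topology = UNIV"
  by (simp only: weak_topology_def topology_generated_by_topspace Union_weak_subbasis)

lemma openin_weak_topology:
  assumes "\<phi> \<in> cdual" "open W"
  shows "openin weak_topology (\<phi> -` W)"
  unfolding weak_topology_def
  by (rule topology_generated_by_Basis, rule CollectI, rule exI[of _ \<phi>], rule exI[of _ W])
    (simp add: assms)

lemma continuous_map_into_weak_topology:
  assumes "\<And>\<phi> W. \<phi> \<in> cdual \<Longrightarrow> open W \<Longrightarrow> openin X ((\<phi> \<circ> g) -` W \<inter> topspace X)"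
  shows "continuous_map X weak_topology g"
  unfolding weak_topology_def
proof (rule continuous_on_generated_topo)
  show "openin X (g -` V \<inter> topspace X)" if V: "V \<in> {\<phi> -` W | \<phi> W. \<phi> \<in> cdual \<and> open W}" for V
  proof -
    obtain \<phi> W where \<phi>: "V = \<phi> -` W" "\<phi> \<in> cdual" "open W"
      using V by (elim CollectE exE conjE)
    from assms[OF \<phi>(2,3)] show ?thesis by (simp only: \<phi>(1) vimage_comp)
  qed
qed (simp only: Union_weak_subbasis subset_UNIV)

lemma continuous_map_weak_isometry:
  assumes "linear_isometry \<iota>"
  shows "continuous_map weak_topology weak_topology \<iota>"
  by (rule continuous_map_into_weak_topology)
    (simp add: openin_weak_topology cdual_compose_isometry[OF assms])

text \<open>
  A subbasic weakly open set \<open>\<phi> -` W\<close> of the domain is the trace of \<open>\<Phi> -` W\<close> for an extension \<open>\<Phi>\<close>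
  of \<open>\<phi>\<close>, so the weak topology of the domain is the one inherited from the codomain.
\<close>

lemma continuous_map_weak_inv_isometry:
  fixes \<iota> :: "'f::complex_normed_vector \<Rightarrow> 'g::complex_normed_vector"
  assumes \<iota>: "linear_isometry \<iota>"
  shows "continuous_map (subtopology weak_topology (range \<iota>)) weak_topology (inv \<iota>)"
proof (rule continuous_map_into_weak_topology)
  fix \<phi> :: "'f \<Rightarrow> complex" and W :: "complex set"
  assume "\<phi> \<in> cdual" "open W"
  obtain \<Phi> where \<Phi>: "\<Phi> \<in> cdual" "\<Phi> \<circ> \<iota> = \<phi>"
    using cdual_extends_along_isometry[OF \<iota> \<open>\<phi> \<in> cdual\<close>] .
  have "(\<phi> \<circ> inv \<iota>) -` W \<inter> range \<iota> = \<Phi> -` W \<inter> range \<iota>"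
    using linear_isometryD(5)[OF \<iota>] by (auto simp flip: \<Phi>(2))
  then show "openin (subtopology weak_topology (range \<iota>))
      ((\<phi> \<circ> inv \<iota>) -` W \<inter> topspace (subtopology weak_topology (range \<iota>)))"
    using openin_weak_topology[OF \<Phi>(1) \<open>open W\<close>] by (auto simp: openin_subtopology)
qed

lemma closed_range_isometry:
  fixes \<iota> :: "'f::complex_banach \<Rightarrow> 'g::complex_normed_vector"
  assumes "linear_isometry \<iota>"
  shows "closed (range \<iota>)"
proof -
  have "complete (range \<iota>)"
    by (rule complete_isometric_image[of 1])
      (simp_all add: linear_isometryD[OF assms] complete_UNIV)
  then show ?thesis by (rule complete_imp_closed)
qed

text \<open>Each point off the range has the weak neighbourhood \<open>{z. \<Phi> z \<noteq> 0}\<close> for a separating \<open>\<Phi>\<close>.\<close>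

lemma weakly_closed_range_isometry:
  fixes \<iota> :: "'f::complex_banach \<Rightarrow> 'g::complex_normed_vector"
  assumes \<iota>: "linear_isometry \<iota>"
  shows "closedin weak_topology (range \<iota>)"
proof -
  have "openin weak_topology (- range \<iota>)"
  proof (subst openin_subopen, safe)
    fix y assume "y \<notin> range \<iota>"
    then obtain \<Phi> where \<Phi>: "\<Phi> \<in> cdual" "\<And>x. \<Phi> (\<iota> x) = 0" "\<Phi> y \<noteq> 0"
      using cdual_separates_closed_range[OF \<iota> closed_range_isometry[OF \<iota>]] by blast
    show "\<exists>T. openin weak_topology T \<and> y \<in> T \<and> T \<subseteq> - range \<iota>"
      using \<Phi> openin_weak_topology[OF \<Phi>(1), of "- {0}"]
      by (intro exI[of _ "\<Phi> -` (- {0})"]) auto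
  qed
  then show ?thesis by (simp add: closedin_def flip: Compl_eq_Diff_UNIV)
qed

text \<open>
  Since the range is closed, the closure of \<open>\<iota> ` S\<close> stays inside it and can be carried back by the
  inverse of \<open>\<iota>\<close>; the resulting compact set contains the closure of \<open>S\<close>.
\<close>

lemma compactin_closure_of_embedding_imageD:
  assumes cont: "continuous_map X Y \<iota>" and inj: "inj_on \<iota> (topspace X)"
    and inv: "continuous_map (subtopology Y (\<iota> ` topspace X)) X (inv_into (topspace X) \<iota>)"
    and range: "closedin Y (\<iota> ` topspace X)"
    and S: "S \<subseteq> topspace X" and comp: "compactin Y (Y closure_of (\<iota> ` S))"
  shows "compactin X (X closure_of S)"
proof -
  let ?R = "\<iota> ` topspace X" and ?K = "Y closure_of (\<iota> ` S)"
  have "?K \<subseteq> ?R" using S range by (intro closure_of_minimal) auto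
  then have "compactin X (inv_into (topspace X) \<iota> ` ?K)"
    using comp by (intro image_compactin[OF _ inv]) (simp add: compactin_subtopology)
  moreover have "X closure_of S \<subseteq> inv_into (topspace X) \<iota> ` ?K"
  proof
    fix x assume x: "x \<in> X closure_of S"
    then have "\<iota> x \<in> ?K" using continuous_map_image_closure_subset[OF cont] by blast
    moreover have "x \<in> topspace X" using x closure_of_subset_topspace by fast
    ultimately show "x \<in> inv_into (topspace X) \<iota> ` ?K"
      using inv_into_f_f[OF inj] by (metis image_eqI)
  qed
  ultimately show ?thesis by (rule closed_compactin) simp
qed

section \<open>Smallness of a set and of its isometric image\<close>

lemma continuous_on_inv_isometry:
  assumes \<iota>: "linear_isometry \<iota>"
  shows "continuous_on (range \<iota>) (inv \<iota>)"
proof -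
  note iso = linear_isometryD[OF \<iota>]
  have "dist (inv \<iota> a) (inv \<iota> b) = dist a b" if "a \<in> range \<iota>" "b \<in> range \<iota>" for a b
    using that iso(3) by (auto simp: dist_norm inv_f_f[OF iso(5)] simp flip: linear_diff[OF iso(2)])
  then show ?thesis
    by (intro lipschitz_on_continuous_on[of 1] lipschitz_onI) simp_all
qed

lemma finite_dim_span_isometry_imageD:
  assumes \<iota>: "linear_isometry \<iota>" and fin: "finite_dim_span (\<iota> ` S)"
  shows "finite_dim_span S"
proof -
  note iso = linear_isometryD[OF \<iota>]
  have span: "complex_vector.span (\<iota> ` T) = \<iota> ` complex_vector.span T" for T
    using module_hom.span_image[OF module_hom_linearI[OF iso(1)]] .
  obtain B where B: "finite B" "complex_vector.span (\<iota> ` S) = complex_vector.span B"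
    using fin by (auto simp: finite_dim_span_def)
  \<comment> \<open>The finite spanning set lies in the span of \<open>\<iota> ` S\<close>, so it can be pulled back.\<close>
  have "B \<subseteq> range \<iota>"
    using complex_vector.span_superset[of B] B(2) span[of S]
    by (metis image_mono subset_UNIV subset_trans)
  then obtain B' where B': "finite B'" "B = \<iota> ` B'"
    using finite_subset_image[OF B(1)] by metis
  have "complex_vector.span S = complex_vector.span B'"
    using B(2) by (simp add: B' span inj_image_eq_iff[OF iso(5)])
  then show ?thesis using B'(1) by (auto simp: finite_dim_span_def)
qed

lemma relatively_compact_isometry_imageD:
  fixes \<iota> :: "'f::complex_banach \<Rightarrow> 'g::complex_normed_vector"
  assumes \<iota>: "linear_isometry \<iota>" and "relatively_compact (\<iota> ` S)"
  shows "relatively_compact S"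
proof -
  have "compactin euclidean (euclidean closure_of S)"
  proof (rule compactin_closure_of_embedding_imageD[of _ euclidean \<iota>])
    show "continuous_map euclidean euclidean \<iota>"
      using linear_continuous_on[OF linear_isometryD(4)[OF \<iota>]] by simp
  qed (use assms(2) linear_isometryD(5)[OF \<iota>] continuous_on_inv_isometry[OF \<iota>]
      closed_range_isometry[OF \<iota>] in \<open>auto simp: relatively_compact_def\<close>)
  then show ?thesis by (simp add: relatively_compact_def)
qed

lemma relatively_weakly_compact_isometry_imageD:
  fixes \<iota> :: "'f::complex_banach \<Rightarrow> 'g::complex_normed_vector"
  assumes \<iota>: "linear_isometry \<iota>" and "relatively_weakly_compact (\<iota> ` S)"
  shows "relatively_weakly_compact S"
  unfolding relatively_weakly_compact_def
  by (rule compactin_closure_of_embedding_imageD[of _ weak_topology \<iota>])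
    (use assms(2) linear_isometryD(5)[OF \<iota>] continuous_map_weak_isometry[OF \<iota>]
      continuous_map_weak_inv_isometry[OF \<iota>] weakly_closed_range_isometry[OF \<iota>]
      in \<open>auto simp: relatively_weakly_compact_def\<close>)

lemma separable_isometry_imageD:
  assumes \<iota>: "linear_isometry \<iota>" and "separable_space (top_of_set (\<iota> ` S))"
  shows "separable_space (top_of_set S)"
proof (rule separable_space_continuous_map_image)
  have eq: "inv \<iota> ` \<iota> ` S = S"
    using linear_isometryD(5)[OF \<iota>] by (simp add: image_comp)
  show "continuous_map (top_of_set (\<iota> ` S)) (top_of_set S) (inv \<iota>)"
    using continuous_on_subset[OF continuous_on_inv_isometry[OF \<iota>], of "\<iota> ` S"] eq
    by (auto simp: continuous_map_in_subtopology)
  show "inv \<iota> ` topspace (top_of_set (\<iota> ` S)) = topspace (top_of_set S)"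
    using eq by simp
qed fact

text \<open>
  A subsequence whose image is weakly Cauchy is itself weakly Cauchy, because every functional
  factors through \<open>\<iota>\<close>.
\<close>

lemma Rosenthal_set_isometry_imageD:
  assumes \<iota>: "linear_isometry \<iota>" and R: "Rosenthal_set (\<iota> ` S)"
  shows "Rosenthal_set S"
  unfolding Rosenthal_set_def
proof (intro allI impI)
  fix s :: "nat \<Rightarrow> _" assume "\<forall>n. s n \<in> S"
  then have "\<forall>n. (\<iota> \<circ> s) n \<in> \<iota> ` S" by simp
  then obtain r where r: "strict_mono r" "weakly_Cauchy ((\<iota> \<circ> s) \<circ> r)"
    using R unfolding Rosenthal_set_def by blast
  have "Cauchy (\<lambda>n. \<phi> ((s \<circ> r) n))" if \<phi>: "\<phi> \<in> cdual" for \<phi>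
  proof -
    obtain \<Phi> where \<Phi>: "\<Phi> \<in> cdual" "\<Phi> \<circ> \<iota> = \<phi>"
      using cdual_extends_along_isometry[OF \<iota> \<phi>] .
    have "Cauchy (\<lambda>n. \<Phi> (((\<iota> \<circ> s) \<circ> r) n))" using r(2) \<Phi>(1) by (simp only: weakly_Cauchy_def)
    then show ?thesis by (simp flip: \<Phi>(2))
  qed
  then show "\<exists>r. strict_mono r \<and> weakly_Cauchy (s \<circ> r)"
    using r(1) by (auto simp: weakly_Cauchy_def)
qed

text \<open>
  Restriction along \<open>\<iota>\<close> maps the dual of the codomain onto the dual of the domain and preserves the
  seminorms, so it carries a countable dense set to a countable dense set.
\<close>

lemma separable_dual_seminorm_isometry_imageD:
  fixes \<iota> :: "'f::complex_normed_vector \<Rightarrow> 'g::complex_normed_vector"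
  assumes \<iota>: "linear_isometry \<iota>" and sep: "separable_dual_seminorm (\<iota> ` B)"
  shows "separable_dual_seminorm B"
proof -
  obtain D where D: "D \<subseteq> cdual" "countable D"
    and dense: "\<And>\<Phi> \<epsilon>. \<Phi> \<in> cdual \<Longrightarrow> \<epsilon> > 0 \<Longrightarrow>
      \<exists>\<Psi>\<in>D. dual_seminorm (\<iota> ` B) (\<lambda>y. \<Phi> y - \<Psi> y) < \<epsilon>"
    using sep unfolding separable_dual_seminorm_def by metis
  show ?thesis
    unfolding separable_dual_seminorm_def
  proof (intro exI[of _ "(\<lambda>\<Psi>. \<Psi> \<circ> \<iota>) ` D"] conjI ballI allI impI)
    show "(\<lambda>\<Psi>. \<Psi> \<circ> \<iota>) ` D \<subseteq> cdual" using D(1) cdual_compose_isometry[OF \<iota>] by auto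
    show "countable ((\<lambda>\<Psi>. \<Psi> \<circ> \<iota>) ` D)" using D(2) by simp
    fix \<phi> :: "'f \<Rightarrow> complex" and \<epsilon> :: real assume \<phi>: "\<phi> \<in> cdual" and "\<epsilon> > 0"
    obtain \<Phi> where \<Phi>: "\<Phi> \<in> cdual" "\<Phi> \<circ> \<iota> = \<phi>"
      using cdual_extends_along_isometry[OF \<iota> \<phi>] .
    obtain \<Psi> where \<Psi>: "\<Psi> \<in> D" "dual_seminorm (\<iota> ` B) (\<lambda>y. \<Phi> y - \<Psi> y) < \<epsilon>"
      using dense[OF \<Phi>(1) \<open>\<epsilon> > 0\<close>] by blast
    have "dual_seminorm B (\<lambda>y. \<phi> y - (\<Psi> \<circ> \<iota>) y) < \<epsilon>"
      using \<Psi>(2) by (simp add: dual_seminorm_def image_image flip: \<Phi>(2))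
    then show "\<exists>\<psi>\<in>(\<lambda>\<Psi>. \<Psi> \<circ> \<iota>) ` D. dual_seminorm B (\<lambda>y. \<phi> y - \<psi> y) < \<epsilon>"
      using \<Psi>(1) by blast
  qed
qed

lemma Asplund_set_isometry_imageD:
  assumes \<iota>: "linear_isometry \<iota>" and A: "Asplund_set (\<iota> ` S)"
  shows "Asplund_set S"
proof -
  have "bounded S"
    using A by (simp add: Asplund_set_def bounded_iff linear_isometryD(3)[OF \<iota>])
  moreover have "separable_dual_seminorm B" if "B \<subseteq> S" "countable B" for B
  proof (rule separable_dual_seminorm_isometry_imageD[OF \<iota>])
    show "separable_dual_seminorm (\<iota> ` B)"
      using A that by (simp add: Asplund_set_def image_mono)
  qed
  ultimately show ?thesis by (simp add: Asplund_set_def)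
qed

lemma ideal_set_isometry_imageD:
  fixes \<iota> :: "'f::complex_banach \<Rightarrow> 'g::complex_banach"
  assumes \<iota>: "linear_isometry \<iota>" and "ideal_set I (\<iota> ` S)"
  shows "ideal_set I S"
  using assms(2) finite_dim_span_isometry_imageD[OF \<iota>] relatively_compact_isometry_imageD[OF \<iota>]
    relatively_weakly_compact_isometry_imageD[OF \<iota>] separable_isometry_imageD[OF \<iota>]
    Rosenthal_set_isometry_imageD[OF \<iota>] Asplund_set_isometry_imageD[OF \<iota>]
  by (cases I) auto

theorem corollary1p12:
  fixes U :: "'e::complex_banach set" and v :: "'e \<Rightarrow> real" and I :: operator_ideal
  assumes "open U" and "weight_on U v"
  shows "injective_ideal U v
    (HvI I U v :: ('e \<Rightarrow> 'f::complex_banach) set) (weighted_norm U v)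
    (HvI I U v :: ('e \<Rightarrow> 'g::complex_banach) set) (weighted_norm U v)"
  unfolding injective_ideal_def
proof (intro ballI allI impI conjI)
  fix f :: "'e \<Rightarrow> 'f" and \<iota> :: "'f \<Rightarrow> 'g"
  assume f: "f \<in> Hv U v" and \<iota>: "linear_isometry \<iota>" and \<iota>f: "\<iota> \<circ> f \<in> HvI I U v"
  note iso = linear_isometryD[OF \<iota>]
  show "weighted_norm U v f = weighted_norm U v (\<iota> \<circ> f)"
    by (simp add: weighted_norm_def iso(3))
  have "weighted_range U v (\<iota> \<circ> f) = \<iota> ` weighted_range U v f"
    by (simp add: weighted_range_def image_image linear_cmul[OF iso(2)])
  then show "f \<in> HvI I U v"
    using f \<iota>f ideal_set_isometry_imageD[OF \<iota>] by (simp add: HvI_def)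
qed

end
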